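(* Let $f:\mathbb{F}_2^s\to\mathbb{F}_2$ and let $g_1,\dots,g_s:\mathbb{F}_2^k\to\mathbb{F}_2$ be balanced functions; define $\hat f(\mathbf{x}_1,\dots,\mathbf{x}_s)=f(g_1(\mathbf{x}_1),\dots,g_s(\mathbf{x}_s))$ for $\mathbf{x}_i\in\mathbb{F}_2^k$. Then for every $\mathbf{w}=(\mathbf{w}_1,\dots,\mathbf{w}_s)\in\mathbb{F}_2^{ks}$ with $\mathbf{w}_i\in\mathbb{F}_2^k$, $$W_{\hat f}(\mathbf{w})=2^{-s}W_f(\mathbf{v}')\prod_{i=1}^s\Big(\tfrac{1+(-1)^{v_i'}}{2}\,2^k+\tfrac{1-(-1)^{v_i'}}{2}\,W_{g_i}(\mathbf{w}_i)\Big),$$ where $\mathbf{v}'=(v_1',\dots,v_s')\in\mathbb{F}_2^s$ has $v_i'=1$ iff $\mathbf{w}_i\ne\mathbf{0}_k$. Furthermore, $$NL(\hat f)\ge 2^{ks-1}-2^{ks-k-s-1}\big(2^s-2NL(f)\big)\Big(2^k-2\min_{1\le i\le s}NL(g_i)\Big).$$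
   Context: For $h:\mathbb{F}_2^m\to\mathbb{F}_2$, $W_h(\mathbf{w})=\sum_{\mathbf{x}}(-1)^{h(\mathbf{x})\oplus\mathbf{w}\cdot\mathbf{x}}$. A function is balanced if it takes the value $1$ on exactly half of its inputs. $NL(h)$ is the nonlinearity, the minimum Hamming distance from the truth table of $h$ to that of an affine function; equivalently $NL(h)=2^{m-1}-\tfrac12\max_{\mathbf{w}}|W_h(\mathbf{w})|$.
   Formalization: The nonlinearity bound is proved for balanced f only; for arbitrary f it fails (s=1, k=3, f=0, g_1=x_1x_2+x_3 gives NL(f̂)=0 but right-hand side 2). The Walsh formula is proved for arbitrary f. *)

theory Defs
  imports "HOL-Analysis.Finite_Cartesian_Product" "HOL-Library.Z2"
begin

text \<open>
  \<open>\<F>\<^sub>2\<close> is the type \<^typ>\<open>bit\<close>, and \<open>\<F>\<^sub>2\<^sup>m\<close> is \<open>bit ^ 'm\<close> with \<open>m = CARD('m)\<close>. Since index types are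
  nonempty, \<open>m \<ge> 1\<close> throughout.
\<close>

instance bit :: finite
proof
  have "(UNIV :: bit set) \<subseteq> {0, 1}"
    by (auto intro: bit.exhaust)
  then show "finite (UNIV :: bit set)"
    by (rule finite_subset) simp
qed

definition bit_sign :: "bit \<Rightarrow> real"
  where "bit_sign b = (-1) ^ (of_bit b :: nat)"

definition bdot :: "bit ^ 'm::finite \<Rightarrow> bit ^ 'm \<Rightarrow> bit"
  where "bdot w x = (\<Sum>i\<in>UNIV. w $ i * x $ i)"

definition walsh :: "(bit ^ 'm::finite \<Rightarrow> bit) \<Rightarrow> bit ^ 'm \<Rightarrow> real"
  where "walsh h w = (\<Sum>x\<in>UNIV. bit_sign (h x + bdot w x))"

definition balanced :: "(bit ^ 'm::finite \<Rightarrow> bit) \<Rightarrow> bool"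
  where "balanced h \<longleftrightarrow> 2 * card {x. h x = 1} = CARD(bit ^ 'm)"

definition affine_fun :: "(bit ^ 'm::finite \<Rightarrow> bit) \<Rightarrow> bool"
  where "affine_fun l \<longleftrightarrow> (\<exists>a c. \<forall>x. l x = bdot a x + c)"

definition hamming_dist :: "(bit ^ 'm::finite \<Rightarrow> bit) \<Rightarrow> (bit ^ 'm \<Rightarrow> bit) \<Rightarrow> nat"
  where "hamming_dist h l = card {x. h x \<noteq> l x}"

definition nonlinearity :: "(bit ^ 'm::finite \<Rightarrow> bit) \<Rightarrow> nat"
  where "nonlinearity h = Min {hamming_dist h l | l. affine_fun l}"

text \<open>
  A vector of \<open>\<F>\<^sub>2\<^sup>k\<^sup>s\<close> is indexed by \<open>'s \<times> 'k\<close>, so that the notions above apply to functions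
  on \<open>\<F>\<^sub>2\<^sup>k\<^sup>s\<close> as they stand; its \<open>i\<close>-th block in \<open>\<F>\<^sub>2\<^sup>k\<close> is \<open>block x i\<close>.
\<close>

definition block :: "bit ^ ('s::finite \<times> 'k::finite) \<Rightarrow> 's \<Rightarrow> bit ^ 'k"
  where "block x i = (\<chi> j. x $ (i, j))"

definition block_compose ::
  "(bit ^ 's::finite \<Rightarrow> bit) \<Rightarrow> ('s \<Rightarrow> bit ^ 'k::finite \<Rightarrow> bit) \<Rightarrow> bit ^ ('s \<times> 'k) \<Rightarrow> bit"
  where "block_compose f g x = f (\<chi> i. g i (block x i))"

definition block_support :: "bit ^ ('s::finite \<times> 'k::finite) \<Rightarrow> bit ^ 's"
  where "block_support w = (\<chi> i. if block w i \<noteq> 0 then 1 else 0)"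

end

theory Submission
  imports Defs
begin

text \<open>
  Fixing the value \<open>y\<close> of \<open>(g\<^sub>1(x\<^sub>1), \<dots>, g\<^sub>s(x\<^sub>s))\<close> splits the Walsh sum of \<open>f\<close> composed with
  the \<open>g\<^sub>i\<close> into \<open>\<Sum>\<^sub>y (-1)\<^bsup>f(y)\<^esup> \<Prod>\<^sub>i S\<^sub>i(y\<^sub>i)\<close>, where \<open>S\<^sub>i(b)\<close> is the sum of
  \<open>(-1)\<^bsup>w\<^sub>i \<cdot> x\<^esup>\<close> over the fibre \<open>g\<^sub>i = b\<close>. For \<open>w\<^sub>i = 0\<close> both fibre sums are \<open>2\<^bsup>k-1\<^esup>\<close> because
  \<open>g\<^sub>i\<close> is balanced; for \<open>w\<^sub>i \<noteq> 0\<close> they add up to \<open>0\<close> and differ by \<open>W\<^bsub>g\<^sub>i\<^esub>(w\<^sub>i)\<close>. Either way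
  \<open>S\<^sub>i(b)\<close> is \<open>(-1)\<^bsup>v\<^sub>i b\<^esup>\<close> times a constant, and the sum over \<open>y\<close> becomes \<open>W\<^sub>f(v)\<close>.
  For the nonlinearity bound, the term \<open>v = 0\<close> vanishes since \<open>f\<close> is balanced, and for \<open>v \<noteq> 0\<close> at
  least one factor of the product is a Walsh coefficient of some \<open>g\<^sub>i\<close>.
\<close>

text \<open>As simp rules these turn sums of bits into \<open>of_bool\<close> of a formula, which hides the ring structure.\<close>
declare add_bit_eq_xor [simp del] mult_bit_eq_and [simp del]

section \<open>Signs of bits and character sums\<close>

lemma bit_sign_0 [simp]: "bit_sign 0 = 1"
  and bit_sign_1 [simp]: "bit_sign 1 = -1"
  by (simp_all add: bit_sign_def)

lemma bit_sign_add: "bit_sign (a + b) = bit_sign a * bit_sign b"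
  by (cases a; cases b) simp_all

lemma bit_sign_sum: "finite A \<Longrightarrow> bit_sign (\<Sum>i\<in>A. h i) = (\<Prod>i\<in>A. bit_sign (h i))"
  by (induction A rule: finite_induct) (simp_all add: bit_sign_add)

lemma UNIV_bit: "(UNIV :: bit set) = {0, 1}"
  by (auto intro: bit.exhaust)

lemma CARD_bit [simp]: "CARD(bit) = 2"
  by (simp add: UNIV_bit)

lemma CARD_bit_vec: "CARD(bit ^ 'm::finite) = 2 ^ CARD('m)"
  by simp

lemma bdot_0_left [simp]: "bdot 0 x = 0"
  by (simp add: bdot_def)

lemma bdot_add_right: "bdot w (x + y) = bdot w x + bdot w y"
  by (simp add: bdot_def distrib_left sum.distrib)

lemma bdot_axis: "bdot w (axis i 1) = w $ i"
proof -
  have "bdot w (axis i 1) = (\<Sum>j\<in>UNIV. if j = i then w $ i else 0)"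
    unfolding bdot_def by (intro sum.cong) (auto simp: axis_def)
  then show ?thesis by simp
qed

text \<open>Translating \<open>x\<close> by the unit vector at a nonzero coordinate of
  \<open>w\<close> flips every sign, so the sum equals its own negative.\<close>

lemma sum_bit_sign_bdot:
  fixes w :: "bit ^ 'm::finite"
  assumes "w \<noteq> 0"
  shows "(\<Sum>x\<in>UNIV. bit_sign (bdot w x)) = 0"
proof -
  from assms obtain i where i: "w $ i \<noteq> 0"
    by (auto simp: vec_eq_iff)
  then have wi: "w $ i = 1" by simp
  have "(\<Sum>x\<in>UNIV. bit_sign (bdot w x)) = (\<Sum>x\<in>UNIV. bit_sign (bdot w (x + axis i 1)))"
    by (rule sum.reindex_bij_witness[where i="\<lambda>x. x + axis i 1" and j="\<lambda>x. x - axis i 1"]) auto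
  also have "\<dots> = - (\<Sum>x\<in>UNIV. bit_sign (bdot w x))"
    by (simp add: bdot_add_right bdot_axis wi bit_sign_add sum_negf)
  finally show ?thesis by simp
qed

lemma sum_bit_sign_eq_card:
  fixes h :: "bit ^ 'm::finite \<Rightarrow> bit"
  shows "(\<Sum>x\<in>UNIV. bit_sign (h x)) = 2 ^ CARD('m) - 2 * real (card {x. h x = 1})"
proof -
  have "(\<Sum>x\<in>UNIV. bit_sign (h x)) = (\<Sum>x\<in>UNIV. 1 - 2 * of_bool (h x = 1))"
    by (intro sum.cong) (auto simp: of_bool_def)
  also have "\<dots> = 2 ^ CARD('m) - 2 * (\<Sum>x\<in>UNIV. of_bool (h x = 1))"
    by (simp add: sum_subtractf sum_distrib_left)
  finally show ?thesis by (simp add: sum.If_cases of_bool_def)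
qed

lemma sum_bit_sign_balanced:
  fixes h :: "bit ^ 'm::finite \<Rightarrow> bit"
  assumes "balanced h"
  shows "(\<Sum>x\<in>UNIV. bit_sign (h x)) = 0"
proof -
  have "2 * real (card {x. h x = 1}) = 2 ^ CARD('m)"
    using assms unfolding balanced_def CARD_bit_vec
    by (metis of_nat_mult of_nat_numeral of_nat_power)
  then show ?thesis by (simp add: sum_bit_sign_eq_card)
qed

lemma walsh_0_balanced: "balanced h \<Longrightarrow> walsh h 0 = 0"
  by (simp add: walsh_def sum_bit_sign_balanced)

section \<open>Nonlinearity through Walsh coefficients\<close>

lemma hamming_dist_affine:
  fixes h :: "bit ^ 'm::finite \<Rightarrow> bit"
  shows "2 * real (hamming_dist h (\<lambda>x. bdot a x + c)) = 2 ^ CARD('m) - bit_sign c * walsh h a"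
proof -
  \<comment> \<open>As a sum of signs, the right-hand side counts agreements of \<open>h\<close>
    with the affine function minus disagreements.\<close>
  have "bit_sign c * walsh h a = (\<Sum>x\<in>UNIV. bit_sign (h x + (bdot a x + c)))"
    by (simp add: walsh_def sum_distrib_left bit_sign_add mult_ac)
  also have "\<dots> = 2 ^ CARD('m) - 2 * real (card {x. h x + (bdot a x + c) = 1})"
    by (rule sum_bit_sign_eq_card)
  also have "{x. h x + (bdot a x + c) = 1} = {x. h x \<noteq> bdot a x + c}"
  proof -
    have "u + v = 1 \<longleftrightarrow> u \<noteq> v" for u v :: bit
      by (cases u; cases v) simp_all
    then show ?thesis by blast
  qed
  finally show ?thesis by (simp add: hamming_dist_def)
qed

lemma finite_affine_dists: "finite {hamming_dist h l | l. affine_fun l}"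
  by simp

lemma nonlinearity_attained:
  obtains a c where "nonlinearity h = hamming_dist h (\<lambda>x. bdot a x + c)"
proof -
  have "affine_fun (\<lambda>x. bdot 0 x + 0)"
    unfolding affine_fun_def by blast
  then have "{hamming_dist h l | l. affine_fun l} \<noteq> {}" by blast
  from Min_in[OF finite_affine_dists this]
  obtain l where l: "affine_fun l" "nonlinearity h = hamming_dist h l"
    by (auto simp: nonlinearity_def)
  then obtain a c where "l = (\<lambda>x. bdot a x + c)"
    by (auto simp: affine_fun_def)
  with l that show thesis by blast
qed

lemma nonlinearity_le: "nonlinearity h \<le> hamming_dist h (\<lambda>x. bdot a x + c)"
  unfolding nonlinearity_def
  by (rule Min_le[OF finite_affine_dists]) (auto simp: affine_fun_def)

text \<open>The constants 0 and 1 in the affine function give the two signs of the coefficient,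
  hence its absolute value.\<close>

lemma abs_walsh_le:
  fixes h :: "bit ^ 'm::finite \<Rightarrow> bit"
  shows "\<bar>walsh h w\<bar> \<le> 2 ^ CARD('m) - 2 * real (nonlinearity h)"
  using hamming_dist_affine[of h w 0] hamming_dist_affine[of h w 1]
    nonlinearity_le[of h w 0] nonlinearity_le[of h w 1]
  by simp

text \<open>The distance to a nearest affine function is determined by one signed Walsh coefficient,
  so a uniform bound suffices.\<close>

lemma nonlinearity_ge:
  fixes h :: "bit ^ 'm::finite \<Rightarrow> bit"
  assumes "\<And>w. \<bar>walsh h w\<bar> \<le> B"
  shows "2 ^ CARD('m) - B \<le> 2 * real (nonlinearity h)"
proof -
  obtain a c where ac: "nonlinearity h = hamming_dist h (\<lambda>x. bdot a x + c)"
    by (rule nonlinearity_attained)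
  have "bit_sign c * walsh h a \<le> \<bar>walsh h a\<bar>"
    by (cases c) auto
  with assms[of a] show ?thesis
    by (simp add: ac hamming_dist_affine)
qed

section \<open>Splitting vectors into blocks\<close>

lemma bdot_block: "bdot w x = (\<Sum>i\<in>UNIV. bdot (block w i) (block x i))"
  unfolding bdot_def block_def
  by (simp add: sum.cartesian_product flip: UNIV_Times_UNIV)

lemma bij_blocks:
  "bij (\<lambda>x :: bit ^ ('s::finite \<times> 'k::finite). block x)"
  by (rule o_bij[where g="\<lambda>b. \<chi> p. b (fst p) $ snd p"])
    (auto simp: block_def fun_eq_iff vec_eq_iff)

text \<open>The blocks of \<open>x\<close> range independently over all families of vectors, so
  distributivity applies.\<close>

lemma sum_prod_blocks:
  fixes F :: "'s::finite \<Rightarrow> bit ^ 'k::finite \<Rightarrow> real"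
  shows "(\<Sum>x\<in>UNIV. \<Prod>i\<in>UNIV. F i (block x i)) = (\<Prod>i\<in>UNIV. \<Sum>y\<in>UNIV. F i y)"
proof -
  have "(\<Sum>x\<in>UNIV. \<Prod>i\<in>UNIV. F i (block x i)) = (\<Sum>b\<in>UNIV. \<Prod>i\<in>UNIV. F i (b i))"
    by (rule sum.reindex_bij_betw[OF bij_blocks])
  then show ?thesis
    by (simp add: prod_sum_PiE)
qed

text \<open>This is the factor in the product formula: the weights (1 + (-1)^v)/2 and (1 - (-1)^v)/2
  are 0 and 1 in some order and select one case.\<close>

definition walsh_factor :: "(bit ^ 'k::finite \<Rightarrow> bit) \<Rightarrow> bit ^ 'k \<Rightarrow> real"
  where "walsh_factor h w = (if w = 0 then 2 ^ CARD('k) else walsh h w)"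

lemma sum_fibre_bit_sign:
  fixes h :: "bit ^ 'k::finite \<Rightarrow> bit"
  assumes "balanced h"
  shows "(\<Sum>x\<in>UNIV. of_bool (h x = b) * bit_sign (bdot w x)) =
    bit_sign ((if w \<noteq> 0 then 1 else 0) * b) * walsh_factor h w / 2"
proof -
  \<comment> \<open>The indicator of a bit value is expanded in signs, which produces a character
    sum and a Walsh coefficient.\<close>
  have *: "of_bool (u = b) = (1 + bit_sign b * bit_sign u) / 2" for u
    by (cases u; cases b) simp_all
  have "(\<Sum>x\<in>UNIV. of_bool (h x = b) * bit_sign (bdot w x)) =
      ((\<Sum>x\<in>UNIV. bit_sign (bdot w x)) + bit_sign b * walsh h w) / 2"
    by (simp add: * walsh_def bit_sign_add sum_distrib_left sum.distrib algebra_simps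
        flip: sum_divide_distrib)
  then show ?thesis
    by (cases "w = 0") (simp_all add: walsh_factor_def walsh_0_balanced[OF assms] sum_bit_sign_bdot)
qed

lemma walsh_block_compose:
  fixes f :: "bit ^ 's::finite \<Rightarrow> bit" and g :: "'s \<Rightarrow> bit ^ 'k::finite \<Rightarrow> bit"
  assumes "\<And>i. balanced (g i)"
  shows "walsh (block_compose f g) w =
    walsh f (block_support w) * (\<Prod>i\<in>UNIV. walsh_factor (g i) (block w i)) / 2 ^ CARD('s)"
proof -
  let ?v = "block_support w"
  let ?G = "\<lambda>x. \<chi> i. g i (block x i)"
  have "walsh (block_compose f g) w =
      (\<Sum>x\<in>UNIV. bit_sign (f (?G x)) * bit_sign (bdot w x))"
    by (simp add: walsh_def block_compose_def bit_sign_add)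
  \<comment> \<open>Exactly one \<open>y\<close> contributes for each \<open>x\<close>.\<close>
  also have "\<dots> = (\<Sum>x\<in>UNIV. \<Sum>y\<in>UNIV. of_bool (?G x = y) * (bit_sign (f y) * bit_sign (bdot w x)))"
    by (simp add: of_bool_def if_distrib[of "\<lambda>u. u * _"] cong: if_cong)
  also have "\<dots> = (\<Sum>y\<in>UNIV. bit_sign (f y) * (\<Sum>x\<in>UNIV. of_bool (?G x = y) * bit_sign (bdot w x)))"
    by (subst sum.swap) (simp only: sum_distrib_left mult_ac)
  also have "\<dots> = (\<Sum>y\<in>UNIV. bit_sign (f y) * (\<Sum>x\<in>UNIV. \<Prod>i\<in>UNIV.
      of_bool (g i (block x i) = y $ i) * bit_sign (bdot (block w i) (block x i))))"
  proof -
    \<comment> \<open>Equality of vectors is tested coordinatewise, so the summand factors over the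
      blocks.\<close>
    have "of_bool (?G x = y) = (\<Prod>i\<in>UNIV. of_bool (g i (block x i) = y $ i) :: real)" for x y
      by (auto simp: vec_eq_iff intro!: prod_zero[symmetric])
    then show ?thesis
      by (simp add: prod.distrib bdot_block[of w] bit_sign_sum)
  qed
  also have "\<dots> = (\<Sum>y\<in>UNIV. bit_sign (f y) *
      (\<Prod>i\<in>UNIV. bit_sign (?v $ i * y $ i) * walsh_factor (g i) (block w i) / 2))"
    by (subst sum_prod_blocks[where F="\<lambda>i z. of_bool (g i z = _ $ i) * bit_sign (bdot (block w i) z)"])
      (simp add: sum_fibre_bit_sign[OF assms] block_support_def)
  \<comment> \<open>The coordinate signs multiply to the character of \<open>?v\<close> at
    \<open>y\<close>, and the halves to 2^(-s).\<close>
  also have "\<dots> = (\<Sum>y\<in>UNIV. bit_sign (f y) * bit_sign (bdot ?v y)) *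
      (\<Prod>i\<in>UNIV. walsh_factor (g i) (block w i)) / 2 ^ CARD('s)"
    by (simp add: prod.distrib prod_dividef bdot_def bit_sign_sum sum_distrib_left mult_ac
        flip: sum_divide_distrib)
  finally show ?thesis by (simp add: walsh_def bit_sign_add)
qed

section \<open>The nonlinearity bound\<close>

lemma abs_walsh_le_CARD:
  fixes h :: "bit ^ 'm::finite \<Rightarrow> bit"
  shows "\<bar>walsh h w\<bar> \<le> 2 ^ CARD('m)"
  using abs_walsh_le[of h w] by linarith

lemma abs_walsh_block_compose_le:
  fixes f :: "bit ^ 's::finite \<Rightarrow> bit" and g :: "'s \<Rightarrow> bit ^ 'k::finite \<Rightarrow> bit"
  assumes g: "\<And>i. balanced (g i)" and f: "balanced f"
    and M: "\<And>i z. \<bar>walsh (g i) z\<bar> \<le> M"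
  shows "\<bar>walsh (block_compose f g) w\<bar> \<le>
    (2 ^ CARD('s) - 2 * real (nonlinearity f)) * (2 ^ CARD('k)) ^ (CARD('s) - 1) * M / 2 ^ CARD('s)"
proof -
  let ?v = "block_support w" and ?A = "\<lambda>i. walsh_factor (g i) (block w i)"
  let ?N = "2 ^ CARD('s) - 2 * real (nonlinearity f)"
  \<comment> \<open>The index \<open>undefined\<close> is an arbitrary one; any coefficient bounded
    by \<open>M\<close> shows \<open>M\<close> to be nonnegative.\<close>
  have N: "0 \<le> ?N" and M0: "0 \<le> M"
    using abs_walsh_le[of f 0] M[of undefined 0] by linarith+
  show ?thesis
  proof (cases "?v = 0")
    case True
    with N M0 show ?thesis
      by (simp add: walsh_block_compose[OF g] walsh_0_balanced[OF f])
  next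
    case False
    then obtain i where "?v $ i \<noteq> 0" by (auto simp: vec_eq_iff)
    then have "block w i \<noteq> 0" by (auto simp: block_support_def)
    then have Ai: "\<bar>?A i\<bar> \<le> M" using M by (simp add: walsh_factor_def)
    have "\<bar>\<Prod>j\<in>UNIV. ?A j\<bar> = \<bar>?A i\<bar> * (\<Prod>j\<in>UNIV - {i}. \<bar>?A j\<bar>)"
      by (subst prod.remove[of UNIV i]) (auto simp: abs_mult abs_prod)
    \<comment> \<open>Only the factor at \<open>i\<close> is bounded by \<open>M\<close>; all others
      get the trivial bound 2^k, whether or not their block is zero.\<close>
    also have "\<dots> \<le> M * (\<Prod>j\<in>UNIV - {i}. 2 ^ CARD('k))"
      by (intro mult_mono Ai prod_mono prod_nonneg M0)
        (auto simp: walsh_factor_def abs_walsh_le_CARD)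
    also have "\<dots> = M * (2 ^ CARD('k)) ^ (CARD('s) - 1)"
      by (simp add: card_Diff_singleton)
    finally have "\<bar>walsh f ?v\<bar> * \<bar>\<Prod>j\<in>UNIV. ?A j\<bar> \<le> ?N * (M * (2 ^ CARD('k)) ^ (CARD('s) - 1))"
      by (intro mult_mono abs_walsh_le N) auto
    then show ?thesis
      by (simp add: walsh_block_compose[OF g] abs_mult divide_right_mono mult_ac)
  qed
qed

theorem mainTheorem7:
  fixes f :: "bit ^ 's::finite \<Rightarrow> bit"
    and g :: "'s \<Rightarrow> bit ^ 'k::finite \<Rightarrow> bit"
  assumes "\<And>i. balanced (g i)"
  shows "(\<forall>w :: bit ^ ('s \<times> 'k).
            walsh (block_compose f g) w =
              2 powi (- int CARD('s)) * walsh f (block_support w) *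
              (\<Prod>i\<in>UNIV. (1 + bit_sign (block_support w $ i)) / 2 * 2 ^ CARD('k)
                       + (1 - bit_sign (block_support w $ i)) / 2 * walsh (g i) (block w i))) \<and>
         (balanced f \<longrightarrow>
            real (nonlinearity (block_compose f g)) \<ge>
              2 powi (int CARD('k) * int CARD('s) - 1)
              - 2 powi (int CARD('k) * int CARD('s) - int CARD('k) - int CARD('s) - 1)
                * (2 ^ CARD('s) - 2 * real (nonlinearity f))
                * (2 ^ CARD('k) - 2 * real (MIN i. nonlinearity (g i))))"
proof (intro conjI allI impI)
  fix w :: "bit ^ ('s \<times> 'k)"
  have "(1 + bit_sign (block_support w $ i)) / 2 * 2 ^ CARD('k)
      + (1 - bit_sign (block_support w $ i)) / 2 * walsh (g i) (block w i)
      = walsh_factor (g i) (block w i)" for i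
    by (simp add: block_support_def walsh_factor_def)
  then show "walsh (block_compose f g) w =
      2 powi (- int CARD('s)) * walsh f (block_support w) *
      (\<Prod>i\<in>UNIV. (1 + bit_sign (block_support w $ i)) / 2 * 2 ^ CARD('k)
               + (1 - bit_sign (block_support w $ i)) / 2 * walsh (g i) (block w i))"
    by (simp add: walsh_block_compose[OF assms] power_int_minus field_simps)
next
  assume f: "balanced f"
  let ?N = "2 ^ CARD('s) - 2 * real (nonlinearity f)"
  let ?M = "2 ^ CARD('k) - 2 * real (MIN i. nonlinearity (g i))"
  let ?k = "CARD('k)" and ?s = "CARD('s)"
  have M: "\<bar>walsh (g i) z\<bar> \<le> ?M" for i z
  proof -
    \<comment> \<open>The least nonlinearity gives the weakest of the bounds, valid for all
      \<open>g i\<close> at once.\<close>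
    have "(MIN i. nonlinearity (g i)) \<le> nonlinearity (g i)" by simp
    with abs_walsh_le[of "g i" z] show ?thesis by linarith
  qed
  have "2 ^ CARD('s \<times> 'k) - ?N * (2 ^ ?k) ^ (?s - 1) * ?M / 2 ^ ?s
      \<le> 2 * real (nonlinearity (block_compose f g))"
    by (rule nonlinearity_ge[OF abs_walsh_block_compose_le[OF assms f M]])
  moreover have "2 ^ CARD('s \<times> 'k) = 2 * (2 powi (int ?k * int ?s - 1) :: real)"
    by (simp add: power_int_diff mult.commute flip: of_nat_mult)
  moreover have "(2 ^ ?k) ^ (?s - 1) / 2 ^ ?s
      = 2 * (2 powi (int ?k * int ?s - int ?k - int ?s - 1) :: real)"
  proof -
    have "(2 ^ ?k) ^ (?s - 1) = (2 powi (int ?k * int ?s - int ?k) :: real)"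
    proof -
      \<comment> \<open>The natural subtraction \<open>?s - 1\<close> does not truncate, since index
        types are nonempty.\<close>
      have "int ?k * int ?s - int ?k = int (?k * (?s - 1))"
        by (simp add: of_nat_diff Suc_leI algebra_simps)
      then show ?thesis by (simp only: power_int_of_nat power_mult)
    qed
    then show ?thesis by (simp add: power_int_diff)
  qed
  ultimately have "2 * 2 powi (int ?k * int ?s - 1)
      - ?N * (2 * 2 powi (int ?k * int ?s - int ?k - int ?s - 1)) * ?M
      \<le> 2 * real (nonlinearity (block_compose f g))"
    by (metis (no_types, lifting) times_divide_eq_left times_divide_eq_right)
  then show "real (nonlinearity (block_compose f g)) \<ge>
      2 powi (int ?k * int ?s - 1)
      - 2 powi (int ?k * int ?s - int ?k - int ?s - 1) * ?N * ?M"
    by (simp add: algebra_simps)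
qed

end
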